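(* For any integer $n\ge 1$, $\vec{\omega}(\tilde S_n)\ge n$.
   Context: A tournament is an orientation of a complete graph. For a digraph $D$ and a total ordering $\prec$ of $V(D)$, the backedge graph $D^{\prec}$ is the undirected graph with vertex set $V(D)$ in which, for $u\prec v$, $uv$ is an edge if and only if $vu\in A(D)$. The clique number of $D$ is $\vec{\omega}(D)=\min\{\omega(D^{\prec}) : \prec \text{ a total ordering of } V(D)\}$, where $\omega$ is the usual clique number of an undirected graph. For tournaments $T_1,T_2,T_3$, $\Delta(T_1,T_2,T_3)$ is the tournament obtained from disjoint copies of $T_1,T_2,T_3$ by adding all arcs from $T_1$ to $T_2$, all arcs from $T_2$ to $T_3$, and all arcs from $T_3$ to $T_1$. The tournaments $\tilde S_n$ are defined by: $\tilde S_1$ is the one-vertex tournament and, for $n\ge 2$, $\tilde S_n=\Delta(\tilde S_{n-1},\tilde S_{n-1},\tilde S_{n-1})$. *)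

theory Defs
  imports "Graph_Theory.Pair_Digraph" "HOL-Library.Ramsey"
begin

definition tournament :: "'a pair_pre_digraph \<Rightarrow> bool" where
  "tournament D \<longleftrightarrow> pair_digraph D \<and>
     (\<forall>u\<in>pverts D. \<forall>v\<in>pverts D. u \<noteq> v \<longrightarrow> ((u, v) \<in> parcs D \<longleftrightarrow> (v, u) \<notin> parcs D))"

definition clique_number :: "'a set \<Rightarrow> 'a set set \<Rightarrow> nat" where
  "clique_number V E = Max {card K | K. K \<subseteq> V \<and> clique K E}"

text \<open>Total orderings are reflexive linear orders \<open>r\<close> as in \<^const>\<open>linear_order_on\<close>, so
  \<open>u\<close> strictly precedes \<open>v\<close> iff \<open>(u, v) \<in> r\<close> and \<open>u \<noteq> v\<close>. The backedge graph has vertex set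
  \<open>pverts D\<close>; the following is its edge set.\<close>

definition backedges :: "'a pair_pre_digraph \<Rightarrow> 'a rel \<Rightarrow> 'a set set" where
  "backedges D r = {{u, v} | u v. (u, v) \<in> r \<and> u \<noteq> v \<and> (v, u) \<in> parcs D}"

text \<open>Digraphs are finite, so the minimum is over a finite nonempty set.\<close>

definition digraph_clique_number :: "'a pair_pre_digraph \<Rightarrow> nat" where
  "digraph_clique_number D =
     Min {clique_number (pverts D) (backedges D r) | r. linear_order_on (pverts D) r}"

text \<open>With lists as vertices, the three copies are made disjoint by prepending the tags
  \<open>1\<close>, \<open>2\<close>, \<open>3\<close>, and \<open>Delta\<close> stays within one type, so that it can be iterated.\<close>

definition copy :: "nat \<Rightarrow> nat list pair_pre_digraph \<Rightarrow> nat list pair_pre_digraph" where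
  "copy i T = \<lparr> pverts = (#) i ` pverts T, parcs = map_prod ((#) i) ((#) i) ` parcs T \<rparr>"

definition Delta :: "nat list pair_pre_digraph \<Rightarrow> nat list pair_pre_digraph \<Rightarrow>
    nat list pair_pre_digraph \<Rightarrow> nat list pair_pre_digraph" where
  "Delta T\<^sub>1 T\<^sub>2 T\<^sub>3 =
     (let C\<^sub>1 = copy 1 T\<^sub>1; C\<^sub>2 = copy 2 T\<^sub>2; C\<^sub>3 = copy 3 T\<^sub>3 in
      \<lparr> pverts = pverts C\<^sub>1 \<union> pverts C\<^sub>2 \<union> pverts C\<^sub>3,
        parcs = parcs C\<^sub>1 \<union> parcs C\<^sub>2 \<union> parcs C\<^sub>3
          \<union> pverts C\<^sub>1 \<times> pverts C\<^sub>2 \<union> pverts C\<^sub>2 \<times> pverts C\<^sub>3 \<union> pverts C\<^sub>3 \<times> pverts C\<^sub>1 \<rparr>)"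

text \<open>The family starts at index \<open>1\<close>; the value at \<open>0\<close> is a dummy.\<close>

fun S_tilde :: "nat \<Rightarrow> nat list pair_pre_digraph" where
  "S_tilde 0 = \<lparr> pverts = {}, parcs = {} \<rparr>"
| "S_tilde (Suc 0) = \<lparr> pverts = {[]}, parcs = {} \<rparr>"
| "S_tilde (Suc (Suc n)) = Delta (S_tilde (Suc n)) (S_tilde (Suc n)) (S_tilde (Suc n))"

lemma tournament_Delta:
  assumes "tournament T\<^sub>1" "tournament T\<^sub>2" "tournament T\<^sub>3"
  shows "tournament (Delta T\<^sub>1 T\<^sub>2 T\<^sub>3)"
proof -
  interpret T1: pair_digraph T\<^sub>1 using assms by (simp add: tournament_def)
  interpret T2: pair_digraph T\<^sub>2 using assms by (simp add: tournament_def)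
  interpret T3: pair_digraph T\<^sub>3 using assms by (simp add: tournament_def)
  have "pair_digraph (Delta T\<^sub>1 T\<^sub>2 T\<^sub>3)"
  proof
    show "finite (pverts (Delta T\<^sub>1 T\<^sub>2 T\<^sub>3))" "finite (parcs (Delta T\<^sub>1 T\<^sub>2 T\<^sub>3))"
      by (simp_all add: Delta_def copy_def Let_def T1.pair_finite_verts T2.pair_finite_verts
          T3.pair_finite_verts T1.pair_finite_arcs T2.pair_finite_arcs T3.pair_finite_arcs)
  qed (force simp: Delta_def copy_def Let_def
      dest: T1.wellformed' T2.wellformed' T3.wellformed'
        T1.pair_no_loops T2.pair_no_loops T3.pair_no_loops)+
  moreover have "(u, v) \<in> parcs (Delta T\<^sub>1 T\<^sub>2 T\<^sub>3) \<longleftrightarrow> (v, u) \<notin> parcs (Delta T\<^sub>1 T\<^sub>2 T\<^sub>3)"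
    if uv: "u \<in> pverts (Delta T\<^sub>1 T\<^sub>2 T\<^sub>3)" "v \<in> pverts (Delta T\<^sub>1 T\<^sub>2 T\<^sub>3)" "u \<noteq> v" for u v
  proof -
    obtain i x j y where ij: "u = i # x" "v = j # y"
      using uv by (auto simp: Delta_def copy_def Let_def)
    have parcs_eq: "(a # p, b # q) \<in> parcs (Delta T\<^sub>1 T\<^sub>2 T\<^sub>3) \<longleftrightarrow>
        a = 1 \<and> b = 1 \<and> (p, q) \<in> parcs T\<^sub>1 \<or> a = 2 \<and> b = 2 \<and> (p, q) \<in> parcs T\<^sub>2 \<or>
        a = 3 \<and> b = 3 \<and> (p, q) \<in> parcs T\<^sub>3 \<or> a = 1 \<and> b = 2 \<and> p \<in> pverts T\<^sub>1 \<and> q \<in> pverts T\<^sub>2 \<or>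
        a = 2 \<and> b = 3 \<and> p \<in> pverts T\<^sub>2 \<and> q \<in> pverts T\<^sub>3 \<or>
        a = 3 \<and> b = 1 \<and> p \<in> pverts T\<^sub>3 \<and> q \<in> pverts T\<^sub>1" for a b p q
      by (simp add: Delta_def copy_def Let_def image_iff Bex_def) fast
    have ranges: "i = 1 \<and> x \<in> pverts T\<^sub>1 \<or> i = 2 \<and> x \<in> pverts T\<^sub>2 \<or> i = 3 \<and> x \<in> pverts T\<^sub>3"
      "j = 1 \<and> y \<in> pverts T\<^sub>1 \<or> j = 2 \<and> y \<in> pverts T\<^sub>2 \<or> j = 3 \<and> y \<in> pverts T\<^sub>3"
      using uv unfolding ij by (simp_all add: Delta_def copy_def Let_def image_iff)
    have "(x, y) \<in> parcs T \<and> (y, x) \<notin> parcs T \<or> (x, y) \<notin> parcs T \<and> (y, x) \<in> parcs T"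
      if "tournament T" "x \<in> pverts T" "y \<in> pverts T" "x \<noteq> y" for T
      using that unfolding tournament_def by blast
    from this[OF assms(1)] this[OF assms(2)] this[OF assms(3)] show ?thesis
      using ranges uv(3) unfolding ij parcs_eq by (elim disjE) auto
  qed
  ultimately show ?thesis
    unfolding tournament_def by blast
qed

lemma tournament_S_tilde: "tournament (S_tilde n)"
proof (induction n rule: S_tilde.induct)
  case (3 n)
  then show ?case by (simp add: tournament_Delta)
qed (auto simp: tournament_def intro!: pair_digraph.intro pair_fin_digraph.intro
    pair_wf_digraph.intro pair_fin_digraph_axioms.intro pair_loopfree_digraph.intro
    pair_loopfree_digraph_axioms.intro)

end

theory Submission
  imports Defs
begin

text \<open>A clique of the backedge graph stays a clique when a vertex \<open>v\<close> is added that precedes all of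
  it and receives an arc from each of its vertices. In any ordering of \<open>Delta T\<^sub>1 T\<^sub>2 T\<^sub>3\<close> the first
  vertex \<open>v\<close> has this property for every clique contained in the copy from which all arcs go to the
  copy of \<open>v\<close>. Since the ordering restricts to an ordering of that copy, a clique as large as the clique
  number of that copy can be found there, and adding \<open>v\<close> yields one more vertex. So the clique number of
  \<open>Delta T\<^sub>1 T\<^sub>2 T\<^sub>3\<close> exceeds the smallest of the clique numbers of the three parts
  (\<open>digraph_clique_number_Delta\<close>), and the bound for \<open>S_tilde n\<close> follows by induction.\<close>

text \<open>The extrema in the definitions range over finite nonempty sets: clique sizes are bounded by
  the number of vertices, and every set has a linear ordering, even a well-ordering.\<close>

lemma le_clique_number_iff:
  assumes "finite V"
  shows "n \<le> clique_number V E \<longleftrightarrow> (\<exists>K\<subseteq>V. clique K E \<and> n \<le> card K)"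
proof -
  have "finite {card K | K. K \<subseteq> V \<and> clique K E}"
    by (rule finite_subset[of _ "card ` Pow V"]) (use assms in auto)
  moreover have "card {} \<in> {card K | K. K \<subseteq> V \<and> clique K E}"
    by (force simp: clique_def)
  ultimately show ?thesis
    unfolding clique_number_def by (subst Max_ge_iff) auto
qed

lemma le_digraph_clique_number_iff:
  assumes "finite (pverts D)"
  shows "n \<le> digraph_clique_number D \<longleftrightarrow>
    (\<forall>r. linear_order_on (pverts D) r \<longrightarrow>
       (\<exists>K\<subseteq>pverts D. clique K (backedges D r) \<and> n \<le> card K))"
proof -
  let ?S = "{clique_number (pverts D) (backedges D r) | r. linear_order_on (pverts D) r}"
  have "clique_number (pverts D) E \<le> card (pverts D)" for E
    using le_clique_number_iff[OF assms, of "clique_number (pverts D) E" E] card_mono[OF assms]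
    by (meson le_trans order_refl)
  then have "finite ?S"
    by (intro finite_subset[of ?S "{..card (pverts D)}"]) auto
  moreover have "?S \<noteq> {}"
    using well_order_on[of "pverts D"] by (auto simp: well_order_on_def)
  ultimately show ?thesis
    unfolding digraph_clique_number_def
    by (subst Min_ge_iff) (auto simp: le_clique_number_iff[OF assms])
qed

lemma linear_order_on_pullback:
  assumes r: "linear_order_on B r" and f: "inj_on f A" "f ` A \<subseteq> B"
  shows "linear_order_on A {(x, y) \<in> A \<times> A. (f x, f y) \<in> r}"
proof -
  have inB: "f x \<in> B" if "x \<in> A" for x
    using f(2) that by blast
  have inj: "x = y" if "x \<in> A" "y \<in> A" "f x = f y" for x y
    using f(1) that(3,1,2) by (rule inj_onD)
  have "refl_on B r" "trans r" "antisym r" "total_on B r"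
    using r by (simp_all add: order_on_defs)
  note refl = refl_onD[OF this(1)] and trans = transD[OF this(2)]
    and antisym = antisymD[OF this(3)] and total = this(4)[unfolded total_on_def, rule_format]
  show ?thesis
    unfolding order_on_defs
  proof (intro conjI)
    show "refl_on A {(x, y) \<in> A \<times> A. (f x, f y) \<in> r}"
      by (rule refl_onI) (simp add: refl inB)
    show "trans {(x, y) \<in> A \<times> A. (f x, f y) \<in> r}"
      by (rule transI) (use trans in blast)
    show "antisym {(x, y) \<in> A \<times> A. (f x, f y) \<in> r}"
      by (rule antisymI) (simp add: antisym inj)
    show "total_on A {(x, y) \<in> A \<times> A. (f x, f y) \<in> r}"
    proof (rule total_onI)
      fix x y assume "x \<in> A" "y \<in> A" "x \<noteq> y"
      then show "(x, y) \<in> {(x, y) \<in> A \<times> A. (f x, f y) \<in> r} \<or>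
          (y, x) \<in> {(x, y) \<in> A \<times> A. (f x, f y) \<in> r}"
        using total[of "f x" "f y"] inB inj by auto
    qed
  qed auto
qed

lemma linear_order_on_finite_has_first:
  assumes "finite V" "V \<noteq> {}" "linear_order_on V r"
  obtains v where "v \<in> V" "\<And>u. u \<in> V \<Longrightarrow> (v, u) \<in> r"
proof -
  have "refl_on V r" "trans r" "total_on V r"
    using assms(3) by (simp_all add: order_on_defs)
  note refl = refl_onD[OF this(1)] and trans = transD[OF this(2)]
    and total = this(3)[unfolded total_on_def, rule_format]
  have "W \<subseteq> V \<Longrightarrow> \<exists>v\<in>W. \<forall>u\<in>W. (v, u) \<in> r" if "finite W" "W \<noteq> {}" for W
    using that
  proof (induction W rule: finite_ne_induct)
    case (singleton x)
    then show ?case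
      by (simp add: refl)
  next
    case (insert x W)
    then obtain v where v: "v \<in> W" "\<forall>u\<in>W. (v, u) \<in> r"
      by auto
    show ?case
    proof (cases "(v, x) \<in> r")
      case True
      with v show ?thesis
        by auto
    next
      case False
      then have "(x, x) \<in> r" "(x, v) \<in> r"
        using insert.prems v(1) refl total[of x v] by auto
      then have "\<forall>u\<in>insert x W. (x, u) \<in> r"
        using v(2) trans by blast
      then show ?thesis
        by blast
    qed
  qed
  from this[of V] show ?thesis
    using assms that by auto
qed

text \<open>The ordering of the ambient digraph pulls back along an embedding, so an embedded digraph
  brings the large cliques of its own orderings with it.\<close>

lemma clique_in_embedded_digraph:
  assumes fin: "finite (pverts T)"
    and f: "inj_on f (pverts T)" "f ` pverts T \<subseteq> pverts D"
    and arcs: "\<And>x y. (x, y) \<in> parcs T \<Longrightarrow> (f x, f y) \<in> parcs D"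
    and r: "linear_order_on (pverts D) r"
  obtains K where "K \<subseteq> f ` pverts T" "clique K (backedges D r)"
    "digraph_clique_number T \<le> card K"
proof -
  define s where "s = {(x, y) \<in> pverts T \<times> pverts T. (f x, f y) \<in> r}"
  have "linear_order_on (pverts T) s"
    unfolding s_def by (rule linear_order_on_pullback[OF r f])
  then obtain K where K: "K \<subseteq> pverts T" "clique K (backedges T s)"
    "digraph_clique_number T \<le> card K"
    using le_digraph_clique_number_iff[OF fin, of "digraph_clique_number T"] by auto
  have "{f x, f y} \<in> backedges D r" if xy: "x \<in> K" "y \<in> K" "f x \<noteq> f y" for x y
  proof -
    have "x \<noteq> y"
      using xy(3) by auto
    then have "{x, y} \<in> backedges T s"
      using K(2) xy(1,2) by (simp add: clique_def)
    then obtain u v where uv: "{x, y} = {u, v}" "(u, v) \<in> s" "(v, u) \<in> parcs T"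
      by (auto simp: backedges_def)
    have "{f x, f y} = {f u, f v}" "f u \<noteq> f v"
      using uv(1) xy(3) by (auto simp: doubleton_eq_iff)
    moreover have "(f u, f v) \<in> r" "(f v, f u) \<in> parcs D"
      using uv arcs by (simp_all add: s_def)
    ultimately show ?thesis
      by (auto simp: backedges_def)
  qed
  then have "clique (f ` K) (backedges D r)"
    unfolding clique_def by blast
  moreover have "card (f ` K) = card K"
    using f(1) K(1) by (meson card_image inj_on_subset)
  ultimately show ?thesis
    using K by (intro that[of "f ` K"]) auto
qed

lemma clique_insert_first:
  assumes "clique K (backedges D r)"
    and "\<And>u. u \<in> K \<Longrightarrow> (v, u) \<in> r \<and> v \<noteq> u \<and> (u, v) \<in> parcs D"
  shows "clique (insert v K) (backedges D r)"
proof -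
  have "{v, u} \<in> backedges D r" if "u \<in> K" for u
    using assms(2)[OF that] unfolding backedges_def by blast
  then show ?thesis
    using assms(1) unfolding clique_def by (auto simp: insert_commute)
qed

lemma digraph_clique_number_Delta:
  assumes fin: "finite (pverts T\<^sub>1)" "finite (pverts T\<^sub>2)" "finite (pverts T\<^sub>3)"
    and ne: "pverts T\<^sub>1 \<union> pverts T\<^sub>2 \<union> pverts T\<^sub>3 \<noteq> {}"
    and m: "m \<le> digraph_clique_number T\<^sub>1" "m \<le> digraph_clique_number T\<^sub>2"
      "m \<le> digraph_clique_number T\<^sub>3"
  shows "Suc m \<le> digraph_clique_number (Delta T\<^sub>1 T\<^sub>2 T\<^sub>3)"
proof -
  let ?D = "Delta T\<^sub>1 T\<^sub>2 T\<^sub>3"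
  have V: "pverts ?D = (#) 1 ` pverts T\<^sub>1 \<union> (#) 2 ` pverts T\<^sub>2 \<union> (#) 3 ` pverts T\<^sub>3"
    by (simp add: Delta_def copy_def Let_def)
  have finD: "finite (pverts ?D)"
    using fin by (simp add: V)
  have "\<exists>K\<subseteq>pverts ?D. clique K (backedges ?D r) \<and> Suc m \<le> card K"
    if r: "linear_order_on (pverts ?D) r" for r
  proof -
    obtain v where v: "v \<in> pverts ?D" "\<And>u. u \<in> pverts ?D \<Longrightarrow> (v, u) \<in> r"
      using linear_order_on_finite_has_first[OF finD _ r] ne by (auto simp: V)
    \<comment> \<open>\<open>T\<close> is to be the part before the one of \<open>v\<close> in the cyclic order, so that all
      its vertices send backward arcs to \<open>v\<close>.\<close>
    have extend: ?thesis
      if T: "finite (pverts T)" "m \<le> digraph_clique_number T" "(#) i ` pverts T \<subseteq> pverts ?D"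
        and arcs: "\<And>x y. (x, y) \<in> parcs T \<Longrightarrow> (i # x, i # y) \<in> parcs ?D"
        and dom: "\<And>u. u \<in> (#) i ` pverts T \<Longrightarrow> (u, v) \<in> parcs ?D \<and> v \<noteq> u"
      for i T
    proof -
      obtain K where K: "K \<subseteq> (#) i ` pverts T" "clique K (backedges ?D r)"
        "digraph_clique_number T \<le> card K"
        using clique_in_embedded_digraph[OF T(1) _ T(3) arcs r] by auto
      have "clique (insert v K) (backedges ?D r)"
        using K T(3) v dom by (intro clique_insert_first) blast+
      moreover have "finite K" "v \<notin> K"
        using K(1) T(1) dom finite_subset by blast+
      ultimately show ?thesis
        using K T v(1) by (intro exI[of _ "insert v K"]) auto
    qed
    from v(1) consider "v \<in> (#) 1 ` pverts T\<^sub>1" | "v \<in> (#) 2 ` pverts T\<^sub>2" | "v \<in> (#) 3 ` pverts T\<^sub>3"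
      by (auto simp: V)
    then show ?thesis
    proof cases
      case 1
      then show ?thesis
        using fin m by (intro extend[of T\<^sub>3 3]) (auto simp: Delta_def copy_def Let_def)
    next
      case 2
      then show ?thesis
        using fin m by (intro extend[of T\<^sub>1 1]) (auto simp: Delta_def copy_def Let_def)
    next
      case 3
      then show ?thesis
        using fin m by (intro extend[of T\<^sub>2 2]) (auto simp: Delta_def copy_def Let_def)
    qed
  qed
  then show ?thesis
    by (simp add: le_digraph_clique_number_iff[OF finD])
qed

lemma finite_pverts_S_tilde: "finite (pverts (S_tilde n))"
  using tournament_S_tilde[of n] pair_fin_digraph.pair_finite_verts
  by (auto simp: tournament_def pair_digraph_def)

lemma pverts_S_tilde_nonempty: "n \<ge> 1 \<Longrightarrow> pverts (S_tilde n) \<noteq> {}"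
  by (induction n rule: S_tilde.induct) (auto simp: Delta_def copy_def Let_def)

theorem lemma3p8:
  fixes n :: nat
  assumes "n \<ge> 1"
  shows "digraph_clique_number (S_tilde n) \<ge> n"
  using assms
proof (induction n rule: S_tilde.induct)
  case 1
  then show ?case by simp
next
  case 2
  have "clique {[]} E" for E :: "nat list set set"
    by (simp add: clique_def)
  then show ?case
    by (subst le_digraph_clique_number_iff) force+
next
  case (3 n)
  then show ?case
    using finite_pverts_S_tilde[of "Suc n"] pverts_S_tilde_nonempty[of "Suc n"]
    by (simp add: digraph_clique_number_Delta)
qed

end
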